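(* Let $(\mathfrak{g}_0,B_0)$ be a finite dimensional complex quadratic Lie algebra. Any deformation $(\mathfrak{g}_t,B_t)$ of $(\mathfrak{g}_0,B_0)$ is equivalent to a deformation with unchanged bilinear form, i.e. to a deformation $(\mathfrak{g}'_t,B'_t)$ of $(\mathfrak{g}_0,B_0)$ with $B'_t=B_0$.
   Context: A quadratic Lie algebra is a Lie algebra with a non degenerate symmetric invariant bilinear form. Given a quadratic Lie algebra $(\mathfrak{g}_0,B_0)$ with underlying vector space $\mathfrak{g}$ and bracket $[\cdot,\cdot]$, a deformation $(\mathfrak{g}_t,B_t)$ of $(\mathfrak{g}_0,B_0)$ consists of: (1) a formal deformation $\mathfrak{g}_t$ of the Lie algebra in the usual sense: $[X,Y]_t=[X,Y]+tC_1(X,Y)+\cdots$ for $X,Y\in\mathfrak{g}$ (a formal power series in $t$ whose coefficients are skew symmetric bilinear maps $\mathfrak{g}\times\mathfrak{g}\to\mathfrak{g}$, satisfying the Jacobi identity over $\mathbb{C}[[t]]$); (2) a formal (symmetric) bilinear form $B_t=B_0+tB_1+\cdots$ such that $B_t([X,Y]_t,Z)=-B_t(Y,[X,Z]_t)$ for all $X,Y,Z\in\mathfrak{g}$. Two deformations $(\mathfrak{g}_t,B_t)$ and $(\mathfrak{g}'_t,B'_t)$ with brackets $[\cdot,\cdot]_t$, $[\cdot,\cdot]'_t$ are equivalent if there is a formal series $T_t=\mathrm{Id}+tT_1+\cdots$ of linear maps $T_i\in\mathrm{End}(\mathfrak{g})$ such that $[X,Y]'_t=T_t^{-1}([T_t(X),T_t(Y)]_t)$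 and $B'_t(X,Y)=B_t(T_t(X),T_t(Y))$ for all $X,Y\in\mathfrak{g}$. *)

theory Defs
  imports Complex_Main "HOL-Computational_Algebra.Formal_Power_Series"
begin

unbundle fps_syntax

definition bilinear_map ::
  "(complex \<Rightarrow> 'a \<Rightarrow> 'a) \<Rightarrow> (complex \<Rightarrow> 'b \<Rightarrow> 'b) \<Rightarrow>
    ('a::ab_group_add \<Rightarrow> 'a \<Rightarrow> 'b::ab_group_add) \<Rightarrow> bool" where
  "bilinear_map s s' f \<longleftrightarrow>
    (\<forall>x. Vector_Spaces.linear s s' (f x)) \<and> (\<forall>y. Vector_Spaces.linear s s' (\<lambda>x. f x y))"

locale lie_algebra = vector_space scale
  for scale :: "complex \<Rightarrow> 'a::ab_group_add \<Rightarrow> 'a" +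
  fixes brk :: "'a \<Rightarrow> 'a \<Rightarrow> 'a"
  assumes brk_bilinear: "bilinear_map scale scale brk"
    and brk_self: "brk x x = 0"
    and jacobi: "brk x (brk y z) + brk y (brk z x) + brk z (brk x y) = 0"

locale quadratic_lie_algebra = lie_algebra scale brk
  for scale :: "complex \<Rightarrow> 'a::ab_group_add \<Rightarrow> 'a" and brk +
  fixes form :: "'a \<Rightarrow> 'a \<Rightarrow> complex"
  assumes form_bilinear: "bilinear_map scale (*) form"
    and form_sym: "form x y = form y x"
    and form_invariant: "form (brk x y) z = - form y (brk x z)"
    and form_nondegenerate: "(\<And>y. form x y = 0) \<Longrightarrow> x = 0"

text \<open>
  The module $\mathfrak{g}[[t]]$ is the type of formal power series with coefficients in
  $\mathfrak{g}$, and \<^const>\<open>fps_const\<close> embeds $\mathfrak{g}$ into it. A formal series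
  $\sum_n t^n F_n$ of (bi)linear maps is the sequence of its coefficients; the two functions below
  extend such a series $t$-linearly and continuously to $\mathfrak{g}[[t]]$.
\<close>

definition series_map ::
  "(nat \<Rightarrow> 'a \<Rightarrow> 'b) \<Rightarrow> 'a::ab_group_add fps \<Rightarrow> 'b::ab_group_add fps" where
  "series_map T x = Abs_fps (\<lambda>n. \<Sum>i\<le>n. T i (x $ (n - i)))"

definition series_bimap ::
  "(nat \<Rightarrow> 'a \<Rightarrow> 'a \<Rightarrow> 'b) \<Rightarrow> 'a::ab_group_add fps \<Rightarrow> 'a fps \<Rightarrow> 'b::ab_group_add fps" where
  "series_bimap F x y = Abs_fps (\<lambda>n. \<Sum>i\<le>n. \<Sum>j\<le>n - i. F i (x $ j) (y $ (n - i - j)))"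

definition bracket_deformation ::
  "(complex \<Rightarrow> 'a \<Rightarrow> 'a) \<Rightarrow> ('a \<Rightarrow> 'a \<Rightarrow> 'a) \<Rightarrow> (nat \<Rightarrow> 'a \<Rightarrow> 'a \<Rightarrow> 'a::ab_group_add) \<Rightarrow> bool" where
  "bracket_deformation scale brk C \<longleftrightarrow>
    C 0 = brk \<and>
    (\<forall>n. bilinear_map scale scale (C n)) \<and>
    (\<forall>n x y. C n x y = - C n y x) \<and>
    (\<forall>x y z. series_bimap C x (series_bimap C y z) + series_bimap C y (series_bimap C z x)
      + series_bimap C z (series_bimap C x y) = 0)"

definition quadratic_deformation ::
  "(complex \<Rightarrow> 'a \<Rightarrow> 'a) \<Rightarrow> ('a \<Rightarrow> 'a \<Rightarrow> 'a) \<Rightarrow> ('a \<Rightarrow> 'a \<Rightarrow> complex) \<Rightarrow>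
    (nat \<Rightarrow> 'a \<Rightarrow> 'a \<Rightarrow> 'a::ab_group_add) \<Rightarrow> (nat \<Rightarrow> 'a \<Rightarrow> 'a \<Rightarrow> complex) \<Rightarrow> bool" where
  "quadratic_deformation scale brk form C B \<longleftrightarrow>
    bracket_deformation scale brk C \<and>
    B 0 = form \<and>
    (\<forall>n. bilinear_map scale (*) (B n)) \<and>
    (\<forall>n x y. B n x y = B n y x) \<and>
    (\<forall>X Y Z.
      series_bimap B (series_bimap C (fps_const X) (fps_const Y)) (fps_const Z) =
      - series_bimap B (fps_const Y) (series_bimap C (fps_const X) (fps_const Z)))"

text \<open>
  The inverse $T_t^{-1}$ is \<^const>\<open>inv\<close> of the extension of $T_t$ to $\mathfrak{g}[[t]]$. It is a
  two-sided inverse because $T_0$ is the identity, see \<open>bij_series_map\<close> below.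
\<close>

definition equivalent_deformations ::
  "(complex \<Rightarrow> 'a \<Rightarrow> 'a) \<Rightarrow>
    (nat \<Rightarrow> 'a \<Rightarrow> 'a \<Rightarrow> 'a::ab_group_add) \<Rightarrow> (nat \<Rightarrow> 'a \<Rightarrow> 'a \<Rightarrow> complex) \<Rightarrow>
    (nat \<Rightarrow> 'a \<Rightarrow> 'a \<Rightarrow> 'a) \<Rightarrow> (nat \<Rightarrow> 'a \<Rightarrow> 'a \<Rightarrow> complex) \<Rightarrow> bool" where
  "equivalent_deformations scale C B C' B' \<longleftrightarrow>
    (\<exists>T. T 0 = id \<and> (\<forall>n. Vector_Spaces.linear scale scale (T n)) \<and>
      (\<forall>X Y. series_bimap C' (fps_const X) (fps_const Y) =
        inv (series_map T)
          (series_bimap C (series_map T (fps_const X)) (series_map T (fps_const Y)))) \<and>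
      (\<forall>X Y. series_bimap B' (fps_const X) (fps_const Y) =
        series_bimap B (series_map T (fps_const X)) (series_map T (fps_const Y))))"

lemma bij_series_map:
  fixes T :: "nat \<Rightarrow> 'a::ab_group_add \<Rightarrow> 'a"
  assumes T0: "T 0 = id"
  shows "bij (series_map T)"
proof -
  have nth: "series_map T x $ n = x $ n + (\<Sum>i\<in>{1..n}. T i (x $ (n - i)))" for x n
  proof -
    have "{..n} = insert 0 {1..n}" by auto
    then show ?thesis by (simp add: series_map_def T0)
  qed
  show ?thesis
  proof (rule bijI)
    show "inj (series_map T)"
    proof (rule injI)
      fix x y assume eq: "series_map T x = series_map T y"
      have "x $ n = y $ n" for n
      proof (induction n rule: less_induct)
        case (less n)
        have "(\<Sum>i\<in>{1..n}. T i (x $ (n - i))) = (\<Sum>i\<in>{1..n}. T i (y $ (n - i)))"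
          by (rule sum.cong) (use less in auto)
        then show ?case using nth[of x n] nth[of y n] eq by simp
      qed
      then show "x = y" by (simp add: fps_eq_iff)
    qed
    show "surj (series_map T)"
    proof (rule surjI)
      fix y :: "'a fps"
      define step where "step g n = y $ n - (\<Sum>i\<in>{1..n}. T i (g (n - i)))" for g n
      define f where "f = wfrec less_than step"
      have f: "f n = y $ n - (\<Sum>i\<in>{1..n}. T i (f (n - i)))" for n
      proof -
        have "f n = step (cut f less_than n) n"
          unfolding f_def by (rule wfrec) simp
        also have "\<dots> = y $ n - (\<Sum>i\<in>{1..n}. T i (f (n - i)))"
          unfolding step_def by (intro arg_cong2[of _ _ _ _ minus] sum.cong refl)
            (auto simp: cut_def)
        finally show ?thesis .
      qed
      have "series_map T (Abs_fps f) = y"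
        by (rule fps_ext) (subst nth, simp, subst f, simp)
      then show "series_map T ((\<lambda>y. SOME x. series_map T x = y) y) = y"
        by (rule someI)
    qed
  qed
qed

lemma series_bimap_const:
  assumes "\<And>n. bilinear_map s s' (F n)"
  shows "series_bimap F (fps_const X) (fps_const Y) = Abs_fps (\<lambda>n. F n X Y)"
proof -
  have F0: "F n 0 y = 0" "F n x 0 = 0" for n x y
  proof -
    have "Vector_Spaces.linear s s' (\<lambda>x. F n x y)" "Vector_Spaces.linear s s' (F n x)"
      using assms[of n] by (auto simp: bilinear_map_def)
    then show "F n 0 y = 0" "F n x 0 = 0"
      by (auto simp: Vector_Spaces.linear_def dest: module_hom.zero)
  qed
  have inner: "(\<Sum>j\<le>n - i. F i (fps_const X $ j) (fps_const Y $ (n - i - j))) =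
      F i X (fps_const Y $ (n - i))" for n i
  proof -
    have "(\<Sum>j\<le>n - i. F i (fps_const X $ j) (fps_const Y $ (n - i - j))) =
        (\<Sum>j\<le>n - i. if j = 0 then F i X (fps_const Y $ (n - i)) else 0)"
      by (rule sum.cong) (auto simp: F0)
    then show ?thesis by simp
  qed
  have "(\<Sum>i\<le>n. F i X (fps_const Y $ (n - i))) = F n X Y" for n
  proof -
    have "(\<Sum>i\<le>n. F i X (fps_const Y $ (n - i))) =
        (\<Sum>i\<le>n. if i = n then F n X Y else 0)"
      by (rule sum.cong) (auto simp: F0)
    then show ?thesis by simp
  qed
  then show ?thesis
    by (intro fps_ext) (simp only: series_bimap_def fps_nth_Abs_fps inner)
qed

end

theory Submission
  imports Defs
begin

text \<open>
  Nondegeneracy of \<open>B\<^sub>0\<close> allows one to construct, order by order, a series \<open>T\<close> with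
  \<open>B\<^sub>t(T X, T Y) = B\<^sub>0(X, Y)\<close>; transporting the bracket along \<open>T\<close> gives the required deformation.
  Identities are extended from constants to all series by \<open>t\<close>-linearity.
\<close>

section \<open>Modules of formal power series and t-linear maps between them\<close>

text \<open>Multiplication by t. The coefficients form only an abelian group, so it is a shift
  rather than a product with \<open>fps_X\<close>; \<open>fps_scale\<close> likewise takes its
  scalar action as an argument.\<close>

definition fps_timesX :: "'a::ab_group_add fps \<Rightarrow> 'a fps" where
  "fps_timesX x = Abs_fps (\<lambda>n. case n of 0 \<Rightarrow> 0 | Suc m \<Rightarrow> x $ m)"

definition fps_scale :: "(complex \<Rightarrow> 'a \<Rightarrow> 'a) \<Rightarrow> complex \<Rightarrow> 'a::ab_group_add fps \<Rightarrow> 'a fps" where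
  "fps_scale s c x = Abs_fps (\<lambda>n. s c (x $ n))"

lemma fps_timesX_nth [simp]: "fps_timesX x $ 0 = 0" "fps_timesX x $ Suc n = x $ n"
  by (simp_all add: fps_timesX_def)

lemma fps_scale_nth [simp]: "fps_scale s c x $ n = s c (x $ n)"
  by (simp add: fps_scale_def)

text \<open>Linearity over polynomials in t, tested on generators. It already controls all power
  series, since multiples of t^n go to multiples of t^n and so cannot affect lower
  coefficients.\<close>

definition t_linear ::
  "(complex \<Rightarrow> 'a \<Rightarrow> 'a) \<Rightarrow> (complex \<Rightarrow> 'b \<Rightarrow> 'b) \<Rightarrow> ('a::ab_group_add fps \<Rightarrow> 'b::ab_group_add fps) \<Rightarrow> bool"
  where
  "t_linear s s' \<Phi> \<longleftrightarrow>
    (\<forall>x y. \<Phi> (x + y) = \<Phi> x + \<Phi> y) \<and>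
    (\<forall>c x. \<Phi> (fps_scale s c x) = fps_scale s' c (\<Phi> x)) \<and>
    (\<forall>x. \<Phi> (fps_timesX x) = fps_timesX (\<Phi> x))"

lemma t_linear_add: "t_linear s s' \<Phi> \<Longrightarrow> \<Phi> (x + y) = \<Phi> x + \<Phi> y"
  and t_linear_scale: "t_linear s s' \<Phi> \<Longrightarrow> \<Phi> (fps_scale s c x) = fps_scale s' c (\<Phi> x)"
  and t_linear_timesX: "t_linear s s' \<Phi> \<Longrightarrow> \<Phi> (fps_timesX x) = fps_timesX (\<Phi> x)"
  by (auto simp: t_linear_def)

lemma t_linear_zero: "t_linear s s' \<Phi> \<Longrightarrow> \<Phi> 0 = 0"
  using t_linear_add[of s s' \<Phi> 0 0] by simp

lemma t_linear_minus: "t_linear s s' \<Phi> \<Longrightarrow> \<Phi> (- x) = - \<Phi> x"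
  using t_linear_add[of s s' \<Phi> "- x" x] by (simp add: t_linear_zero eq_neg_iff_add_eq_0)

lemma t_linear_compose:
  assumes "t_linear s s' \<Phi>" "t_linear s' s'' \<Psi>"
  shows "t_linear s s'' (\<lambda>x. \<Psi> (\<Phi> x))"
  using assms by (simp add: t_linear_def)

lemma t_linear_uminus:
  fixes \<Phi> :: "'a::ab_group_add fps \<Rightarrow> 'b::ab_group_add fps"
  assumes "vector_space s'" "t_linear s s' \<Phi>"
  shows "t_linear s s' (\<lambda>x. - \<Phi> x)"
proof -
  interpret vector_space s' by fact
  have "fps_timesX (- y) = - fps_timesX y" for y :: "'b fps"
  proof (rule fps_ext)
    show "fps_timesX (- y) $ n = (- fps_timesX y) $ n" for n
      by (cases n) simp_all
  qed
  moreover have "fps_scale s' c (- y) = - fps_scale s' c y" for c y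
    by (rule fps_ext) simp
  ultimately show ?thesis
    using assms(2) by (simp add: t_linear_def)
qed

lemma t_linear_inv:
  assumes "t_linear s s' \<Phi>" "bij \<Phi>"
  shows "t_linear s' s (inv \<Phi>)"
proof -
  have *: "\<Phi> (inv \<Phi> y) = y" for y
    using assms(2) by (simp add: bij_is_surj surj_f_inv_f)
  have eqI: "inv \<Phi> y = x" if "\<Phi> x = y" for x y
    using assms(2) that by (auto simp: bij_is_inj inv_f_f)
  note \<Phi> = t_linear_add[OF assms(1)] t_linear_scale[OF assms(1)] t_linear_timesX[OF assms(1)]
  show ?thesis
    unfolding t_linear_def by (intro conjI allI; rule eqI) (simp_all only: \<Phi> *)
qed

text \<open>Write \<open>x = x\<^sub>0 + t x'\<close> and induct on the index of the coefficient; no continuity is needed.\<close>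

lemma t_linear_eqI:
  assumes \<Phi>: "t_linear s s' \<Phi>" and \<Psi>: "t_linear s s' \<Psi>"
    and const: "\<And>X. \<Phi> (fps_const X) = \<Psi> (fps_const X)"
  shows "\<Phi> x = \<Psi> x"
proof (rule fps_ext)
  fix n
  show "\<Phi> x $ n = \<Psi> x $ n"
  proof (induction n arbitrary: x)
    have decomp: "x = fps_const (x $ 0) + fps_timesX (Abs_fps (\<lambda>n. x $ Suc n))" for x :: "'a fps"
    proof (rule fps_ext)
      show "x $ n = (fps_const (x $ 0) + fps_timesX (Abs_fps (\<lambda>n. x $ Suc n))) $ n" for n
        by (cases n) simp_all
    qed
    have split: "\<Theta> x = \<Theta> (fps_const (x $ 0)) + fps_timesX (\<Theta> (Abs_fps (\<lambda>n. x $ Suc n)))"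
      if "t_linear s s' \<Theta>" for \<Theta> x
      using decomp[of x] t_linear_add[OF that] t_linear_timesX[OF that] by metis
    {
      case 0
      show ?case
        using split[OF \<Phi>, of x] split[OF \<Psi>, of x] const by simp
    next
      case (Suc n)
      then show ?case
        using split[OF \<Phi>, of x] split[OF \<Psi>, of x] const by simp
    }
  qed
qed

lemma t_linear_bi_eqI:
  assumes "\<And>y. t_linear s s' (\<lambda>x. \<Phi> x y)" "\<And>x. t_linear s s' (\<Phi> x)"
    and "\<And>y. t_linear s s' (\<lambda>x. \<Psi> x y)" "\<And>x. t_linear s s' (\<Psi> x)"
    and const: "\<And>X Y. \<Phi> (fps_const X) (fps_const Y) = \<Psi> (fps_const X) (fps_const Y)"
  shows "\<Phi> x y = \<Psi> x y"
proof (rule t_linear_eqI[of s s' "\<lambda>x. \<Phi> x y" "\<lambda>x. \<Psi> x y"])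
  show "\<Phi> (fps_const X) y = \<Psi> (fps_const X) y" for X
    by (rule t_linear_eqI[of s s']) (rule assms)+
qed (rule assms)+

text \<open>The way back from a map on series to a series of maps: restrict to constants and read
  off coefficients.\<close>

lemma t_linear_nth_linear:
  assumes vs: "vector_space s" "vector_space s'" and \<Phi>: "t_linear s s' \<Phi>"
  shows "Vector_Spaces.linear s s' (\<lambda>X. \<Phi> (fps_const X) $ n)"
proof -
  interpret s: vector_space s by (rule vs)
  have "fps_const (s c X) = fps_scale s c (fps_const X)" for c X
    by (rule fps_ext) simp
  then have "\<Phi> (fps_const (s c X)) $ n = s' c (\<Phi> (fps_const X) $ n)" for c X
    using t_linear_scale[OF \<Phi>, of c "fps_const X"] by simp
  moreover have "\<Phi> (fps_const (X + Y)) $ n = \<Phi> (fps_const X) $ n + \<Phi> (fps_const Y) $ n" for X Y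
    using t_linear_add[OF \<Phi>, of "fps_const X" "fps_const Y"] by (simp flip: fps_const_add)
  ultimately show ?thesis
    using vs by (simp add: Vector_Spaces.linear_iff)
qed

section \<open>Series of linear and bilinear maps as t-linear maps\<close>

lemma series_map_t_linear:
  assumes "\<And>n. Vector_Spaces.linear s s' (T n)"
  shows "t_linear s s' (series_map T)"
proof -
  interpret T: Vector_Spaces.linear s s' "T n" for n by (rule assms)
  have "series_map T (fps_timesX x) = fps_timesX (series_map T x)" for x
  proof (rule fps_ext)
    fix n
    show "series_map T (fps_timesX x) $ n = fps_timesX (series_map T x) $ n"
    proof (cases n)
      case 0
      then show ?thesis by (simp add: series_map_def T.zero)
    next
      case (Suc m)
      have "(\<Sum>i\<le>m. T i (fps_timesX x $ (Suc m - i))) = (\<Sum>i\<le>m. T i (x $ (m - i)))"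
        by (intro sum.cong refl) (simp add: Suc_diff_le)
      then show ?thesis using Suc by (simp add: series_map_def T.zero)
    qed
  qed
  then show ?thesis
    by (auto simp: t_linear_def series_map_def T.add T.scale sum.distrib T.vs2.scale_sum_right
        intro!: fps_ext)
qed

lemma series_map_const:
  assumes "\<And>n. Vector_Spaces.linear s s' (T n)"
  shows "series_map T (fps_const X) = Abs_fps (\<lambda>n. T n X)"
proof (rule fps_ext)
  interpret T: Vector_Spaces.linear s s' "T n" for n by (rule assms)
  fix n
  have "(\<Sum>i\<le>n. T i (fps_const X $ (n - i))) = (\<Sum>i\<le>n. if i = n then T n X else 0)"
    by (intro sum.cong refl) (simp add: T.zero)
  then show "series_map T (fps_const X) $ n = Abs_fps (\<lambda>n. T n X) $ n"
    by (simp add: series_map_def)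
qed

text \<open>The n-th coefficient sums \<open>F i (x $ j) (y $ k)\<close> over i + j + k = n, which
  is symmetric in j and k. This turns every fact about the right argument into one about the
  left.\<close>

lemma series_bimap_flip: "series_bimap F x y = series_bimap (\<lambda>n u v. F n v u) y x"
proof -
  have "(\<Sum>j\<le>m. F i (x $ j) (y $ (m - j))) = (\<Sum>j\<le>m. F i (x $ (m - j)) (y $ j))" for i m
    by (rule sum.reindex_bij_witness[of _ "\<lambda>j. m - j" "\<lambda>j. m - j"]) auto
  then show ?thesis
    by (simp add: series_bimap_def del: diff_diff_left)
qed

lemma bilinear_map_flip: "bilinear_map s s' f \<Longrightarrow> bilinear_map s s' (\<lambda>x y. f y x)"
  by (simp add: bilinear_map_def)

lemma series_bimap_t_linear_right:
  assumes "\<And>n. bilinear_map s s' (F n)"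
  shows "t_linear s s' (series_bimap F x)"
proof -
  interpret F: Vector_Spaces.linear s s' "F n u" for n u
    using assms by (simp add: bilinear_map_def)
  have "series_bimap F x (fps_timesX y) = fps_timesX (series_bimap F x y)" for y
  proof (rule fps_ext)
    fix n
    show "series_bimap F x (fps_timesX y) $ n = fps_timesX (series_bimap F x y) $ n"
    proof (cases n)
      case 0
      then show ?thesis by (simp add: series_bimap_def F.zero)
    next
      case (Suc m)
      have inner: "(\<Sum>j\<le>Suc k. F i (x $ j) (fps_timesX y $ (Suc k - j))) = (\<Sum>j\<le>k. F i (x $ j) (y $ (k - j)))"
        for i k
        by (simp add: F.zero) (intro sum.cong refl, simp add: Suc_diff_le)
      have "(\<Sum>i\<le>m. \<Sum>j\<le>Suc m - i. F i (x $ j) (fps_timesX y $ (Suc m - i - j)))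
          = (\<Sum>i\<le>m. \<Sum>j\<le>m - i. F i (x $ j) (y $ (m - i - j)))"
        by (rule sum.cong[OF refl]) (simp only: atMost_iff Suc_diff_le inner)
      then show ?thesis using Suc by (simp add: series_bimap_def F.zero del: diff_diff_left)
    qed
  qed
  then show ?thesis
    by (auto simp: t_linear_def series_bimap_def F.add F.scale sum.distrib F.vs2.scale_sum_right
        intro!: fps_ext)
qed

lemma series_bimap_t_linear_left:
  assumes "\<And>n. bilinear_map s s' (F n)"
  shows "t_linear s s' (\<lambda>x. series_bimap F x y)"
proof -
  have "(\<lambda>x. series_bimap F x y) = series_bimap (\<lambda>n u v. F n v u) y"
    by (rule ext) (rule series_bimap_flip)
  then show ?thesis
    using series_bimap_t_linear_right[OF bilinear_map_flip[OF assms]] by simp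
qed

text \<open>In the sum over i + j + k = n only j = n survives, which forces i = k = 0.\<close>

lemma series_bimap_nth_lowest:
  assumes "\<And>n. bilinear_map s s' (F n)" and low: "\<And>k. k < n \<Longrightarrow> x $ k = 0"
  shows "series_bimap F x y $ n = F 0 (x $ n) (y $ 0)"
proof -
  interpret F: Vector_Spaces.linear s s' "\<lambda>u. F m u v" for m v
    using assms(1) by (simp add: bilinear_map_def)
  have "(\<Sum>j\<le>n - i. F i (x $ j) (y $ (n - i - j))) = (if i = 0 then F 0 (x $ n) (y $ 0) else 0)"
    if "i \<le> n" for i
  proof (cases "i = 0")
    case True
    have "F 0 (x $ j) (y $ (n - j)) = (if j = n then F 0 (x $ n) (y $ 0) else 0)" if "j \<le> n" for j
      using that by (cases "j = n") (simp_all add: low F.zero)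
    then have "(\<Sum>j\<le>n. F 0 (x $ j) (y $ (n - j))) = (\<Sum>j\<le>n. if j = n then F 0 (x $ n) (y $ 0) else 0)"
      by simp
    then show ?thesis using True by simp
  next
    case False
    then show ?thesis using that by (auto simp: low F.zero intro!: sum.neutral)
  qed
  then have "series_bimap F x y $ n = (\<Sum>i\<le>n. if i = 0 then F 0 (x $ n) (y $ 0) else 0)"
    by (simp add: series_bimap_def)
  then show ?thesis by simp
qed

text \<open>Isolates the contribution of the top coefficients \<open>x $ n\<close> and
  \<open>y $ n\<close>, the unknowns when a series is built order by order. Each argument is split
  into its cutoff and a tail starting at order n, and \<open>series_bimap_nth_lowest\<close>
  evaluates the tails. For n = 0 the term \<open>F 0 (x $ 0) (y $ 0)\<close> would be counted
  twice.\<close>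

lemma series_bimap_nth_top:
  assumes F: "\<And>n. bilinear_map s s' (F n)" and n: "n > 0"
  shows "series_bimap F x y $ n =
    series_bimap F (fps_cutoff n x) (fps_cutoff n y) $ n + F 0 (x $ n) (y $ 0) + F 0 (x $ 0) (y $ n)"
proof -
  define x' y' where "x' = x - fps_cutoff n x" and "y' = y - fps_cutoff n y"
  have x: "x = fps_cutoff n x + x'" and y: "y = fps_cutoff n y + y'"
    by (simp_all add: x'_def y'_def)
  note left = t_linear_add[OF series_bimap_t_linear_left[OF F]]
  note right = t_linear_add[OF series_bimap_t_linear_right[OF F]]
  have "series_bimap F x y = series_bimap F (fps_cutoff n x) y + series_bimap F x' y"
    by (subst x, subst left, rule refl)
  also have "series_bimap F (fps_cutoff n x) y
      = series_bimap F (fps_cutoff n x) (fps_cutoff n y) + series_bimap F (fps_cutoff n x) y'"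
    by (subst y, subst right, rule refl)
  finally have "series_bimap F x y $ n = series_bimap F (fps_cutoff n x) (fps_cutoff n y) $ n
      + series_bimap F (fps_cutoff n x) y' $ n + series_bimap F x' y $ n"
    by simp
  moreover have "series_bimap F x' y $ n = F 0 (x $ n) (y $ 0)"
    by (subst series_bimap_nth_lowest[OF F]) (auto simp: x'_def)
  moreover have "series_bimap F (fps_cutoff n x) y' $ n = F 0 (x $ 0) (y $ n)"
    using n by (subst series_bimap_flip, subst series_bimap_nth_lowest[OF bilinear_map_flip[OF F]])
      (auto simp: y'_def)
  ultimately show ?thesis by simp
qed

text \<open>Every t-bilinear map is the extension of the series of its coefficients on constants,
  because both sides are t-bilinear and agree there. Structures pulled back along T thus become
  series of bilinear maps.\<close>

lemma series_bimap_eq_of_t_bilinear: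
  assumes vs: "vector_space s" "vector_space s'"
    and \<Phi>: "\<And>y. t_linear s s' (\<lambda>x. \<Phi> x y)" "\<And>x. t_linear s s' (\<Phi> x)"
    and F: "\<And>n X Y. F n X Y = \<Phi> (fps_const X) (fps_const Y) $ n"
  shows "bilinear_map s s' (F n)" and "series_bimap F x y = \<Phi> x y"
proof -
  have F': "F = (\<lambda>n X Y. \<Phi> (fps_const X) (fps_const Y) $ n)"
    using F by blast
  show bil: "bilinear_map s s' (F n)" for n
    unfolding bilinear_map_def F' using t_linear_nth_linear[OF vs] \<Phi> by blast
  show "series_bimap F x y = \<Phi> x y"
  proof (rule t_linear_bi_eqI[of s s'])
    show "series_bimap F (fps_const X) (fps_const Y) = \<Phi> (fps_const X) (fps_const Y)" for X Y
      by (subst series_bimap_const[OF bil]) (simp add: F fps_eq_iff)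
  qed (rule \<Phi> series_bimap_t_linear_left[OF bil] series_bimap_t_linear_right[OF bil])+
qed

section \<open>Nondegenerate forms and the construction of T\<close>

lemma vector_space_complex: "vector_space ((*) :: complex \<Rightarrow> complex \<Rightarrow> complex)"
  by unfold_locales (simp_all add: algebra_simps)

text \<open>Nondegeneracy makes the map from vectors to functionals injective, and equality of
  dimensions makes it surjective.\<close>

lemma nondegenerate_form_represents:
  fixes scale :: "complex \<Rightarrow> 'a::ab_group_add \<Rightarrow> 'a"
  assumes fin: "finite_dimensional_vector_space scale Basis"
    and form: "bilinear_map scale (*) form"
    and nondeg: "\<And>x. (\<And>y. form x y = 0) \<Longrightarrow> x = 0"
    and \<phi>: "Vector_Spaces.linear scale (*) \<phi>"
  shows "\<exists>u. \<forall>y. form u y = \<phi> y"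
proof -
  interpret finite_dimensional_vector_space scale Basis by fact
  interpret \<phi>: Vector_Spaces.linear scale "(*)" \<phi> by fact
  interpret L: Vector_Spaces.linear scale "(*)" "\<lambda>x. form x y" for y
    using form by (simp add: bilinear_map_def)
  interpret vp: vector_space_pair scale "(*)" ..
  have R: "Vector_Spaces.linear scale (*) (form x)" for x
    using form by (simp add: bilinear_map_def)
  have ext: "f y = g y" if "Vector_Spaces.linear scale (*) f" "Vector_Spaces.linear scale (*) g"
    "\<And>b. b \<in> Basis \<Longrightarrow> f b = g b" for f g :: "'a \<Rightarrow> complex" and y
    by (rule vp.linear_eq_on_span[OF that]) (auto simp: span_Basis)
  \<comment> \<open>A functional is encoded by the vector whose coordinates are its values on
    \<open>Basis\<close>. The map into the dual becomes an endomorphism, for which injectivity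
    implies surjectivity.\<close>
  define G where "G x = (\<Sum>b\<in>Basis. scale (form x b) b)" for x
  have lin: "Vector_Spaces.linear scale scale G"
    by (simp add: Vector_Spaces.linear_iff vector_space_axioms G_def L.add L.scale
        scale_left_distrib sum.distrib scale_sum_right)
  have coeff: "f b = g b" if "(\<Sum>b\<in>Basis. scale (f b) b) = (\<Sum>b\<in>Basis. scale (g b) b)" "b \<in> Basis"
    for f g :: "'a \<Rightarrow> complex" and b
  proof -
    have "(\<Sum>b\<in>Basis. scale (f b - g b) b) = 0"
      using that(1) by (simp add: scale_left_diff_distrib sum_subtractf)
    then have "f b - g b = 0"
      using independentD[OF independent_Basis finite_Basis subset_refl, of "\<lambda>b. f b - g b" b] that(2)
      by simp
    then show ?thesis by simp
  qed
  have "inj G"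
  proof (rule injI)
    fix x x' assume "G x = G x'"
    then have "form x b = form x' b" if "b \<in> Basis" for b
      unfolding G_def by (rule coeff) (rule that)
    then have "form x y = form x' y" for y
      by (rule ext[OF R R])
    then have "x - x' = 0"
      by (intro nondeg) (simp add: L.diff)
    then show "x = x'" by simp
  qed
  then have "surj G"
    by (rule linear_inj_imp_surj[OF lin])
  then obtain u where "G u = (\<Sum>b\<in>Basis. scale (\<phi> b) b)"
    by (metis surjD)
  then have "form u b = \<phi> b" if "b \<in> Basis" for b
    unfolding G_def by (rule coeff) (rule that)
  then show ?thesis
    using ext[OF R \<phi>] by auto
qed

text \<open>Represent \<open>R x\<close> separately for each x; the representing vector is unique by
  nondegeneracy, so it depends linearly on x.\<close>

lemma nondegenerate_form_represents_bilinear: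
  fixes scale :: "complex \<Rightarrow> 'a::ab_group_add \<Rightarrow> 'a"
  assumes fin: "finite_dimensional_vector_space scale Basis"
    and form: "bilinear_map scale (*) form"
    and nondeg: "\<And>x. (\<And>y. form x y = 0) \<Longrightarrow> x = 0"
    and R: "bilinear_map scale (*) R"
  shows "\<exists>S. Vector_Spaces.linear scale scale S \<and> (\<forall>x y. form (S x) y = R x y)"
proof -
  interpret finite_dimensional_vector_space scale Basis by fact
  interpret L: Vector_Spaces.linear scale "(*)" "\<lambda>x. form x y" for y
    using form by (simp add: bilinear_map_def)
  interpret R: Vector_Spaces.linear scale "(*)" "\<lambda>x. R x y" for y
    using R by (simp add: bilinear_map_def)
  have "\<exists>u. \<forall>y. form u y = R x y" for x
    using nondegenerate_form_represents[OF fin form nondeg] R by (simp add: bilinear_map_def)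
  then obtain S where S: "form (S x) y = R x y" for x y
    by metis
  have eqI: "u = v" if "\<And>y. form u y = form v y" for u v
    using nondeg[of "u - v"] that by (simp add: L.diff)
  have "S (x + x') = S x + S x'" "S (scale c x) = scale c (S x)" for x x' c
    by (rule eqI; simp add: S L.add L.scale R.add R.scale)+
  then have "Vector_Spaces.linear scale scale S"
    by (simp add: Vector_Spaces.linear_iff vector_space_axioms)
  then show ?thesis using S by blast
qed

text \<open>
  At order \<open>n\<close> the condition on \<open>T\<close> reads \<open>B\<^sub>0(T\<^sub>n X, Y) + B\<^sub>0(X, T\<^sub>n Y) + R(X, Y) = 0\<close> with
  \<open>R\<close> symmetric and determined by lower orders, so one may choose \<open>T\<^sub>n\<close> with
  \<open>B\<^sub>0(T\<^sub>n X, Y) = - R(X, Y) / 2\<close>.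
\<close>

lemma form_deformation_trivial:
  fixes scale :: "complex \<Rightarrow> 'a::ab_group_add \<Rightarrow> 'a"
  assumes fin: "finite_dimensional_vector_space scale Basis"
    and bil: "\<And>n. bilinear_map scale (*) (B n)"
    and sym: "\<And>n x y. B n x y = B n y x"
    and nondeg: "\<And>x. (\<And>y. B 0 x y = 0) \<Longrightarrow> x = 0"
  obtains T where "T 0 = id" "\<And>n. Vector_Spaces.linear scale scale (T n)"
    "\<And>X Y. series_bimap B (series_map T (fps_const X)) (series_map T (fps_const Y)) = fps_const (B 0 X Y)"
proof -
  interpret finite_dimensional_vector_space scale Basis by fact
  \<comment> \<open>Replacing all terms from order n on by zero makes \<open>R n T\<close> depend
    only on the terms of T already chosen.\<close>
  define low where "low n T = (\<lambda>k. if k < n then T k else (\<lambda>_::'a. 0::'a))" for n :: nat and T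
  define R where "R n T X Y =
    series_bimap B (series_map (low n T) (fps_const X)) (series_map (low n T) (fps_const Y)) $ n"
    for n T X Y
  define P where "P T n S \<longleftrightarrow> Vector_Spaces.linear scale scale S \<and>
    (if n = 0 then S = id else \<forall>X Y. B 0 (S X) Y = - R n T X Y / 2)" for T n S
  have "\<exists>T. \<forall>n. P T n (T n)"
  \<comment> \<open>Each choice depends on all earlier ones. The first goal checks that
    \<open>P T n\<close> sees T only below n, the second that a suitable \<open>S\<close> exists at
    order n.\<close>
  proof (rule dependent_wf_choice[of less_than P])
    fix T U :: "nat \<Rightarrow> 'a \<Rightarrow> 'a" and n S
    assume "\<And>k. (k, n) \<in> less_than \<Longrightarrow> T k = U k"
    then have "low n T = low n U"
      by (auto simp: low_def)
    then show "P T n S = P U n S"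
      by (simp add: P_def R_def)
  next
    fix n and T :: "nat \<Rightarrow> 'a \<Rightarrow> 'a"
    assume IH: "\<And>k. (k, n) \<in> less_than \<Longrightarrow> P T k (T k)"
    have linT: "Vector_Spaces.linear scale scale (low n T k)" for k
      using IH[of k] by (auto simp: low_def P_def Vector_Spaces.linear_iff vector_space_axioms)
    note tl = series_map_t_linear[OF linT]
    \<comment> \<open>\<open>R n T\<close> is the n-th coefficient on constants of the t-bilinear
      pullback of B along the truncated series.\<close>
    have "bilinear_map scale (*) (R n T)"
      by (rule series_bimap_eq_of_t_bilinear(1)[OF vector_space_axioms vector_space_complex, where
            \<Phi> = "\<lambda>x y. series_bimap B (series_map (low n T) x) (series_map (low n T) y)" and
            F = "\<lambda>m X Y. series_bimap B (series_map (low n T) (fps_const X))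
              (series_map (low n T) (fps_const Y)) $ m" and n = n, folded R_def])
        (intro t_linear_compose[OF tl] series_bimap_t_linear_left series_bimap_t_linear_right bil refl)+
    then have "bilinear_map scale (*) (\<lambda>X Y. - R n T X Y / 2)"
      by (simp add: bilinear_map_def Vector_Spaces.linear_iff add_divide_distrib)
    then have "\<exists>S. Vector_Spaces.linear scale scale S \<and> (\<forall>X Y. B 0 (S X) Y = - R n T X Y / 2)"
      by (intro nondegenerate_form_represents_bilinear[OF fin] bil nondeg)
    then show "\<exists>S. P T n S"
      using linear_id unfolding P_def by (cases "n = 0") auto
  qed simp
  then obtain T where T: "\<And>n. P T n (T n)" by blast
  have T0: "T 0 = id" and linT: "\<And>n. Vector_Spaces.linear scale scale (T n)"
    using T unfolding P_def by (metis, blast)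
  have linlow: "Vector_Spaces.linear scale scale (low n T k)" for n k
    using linT by (auto simp: low_def Vector_Spaces.linear_iff)
  \<comment> \<open>On constants, truncating the series of maps cuts off the image, so
    \<open>R n T\<close> is the cutoff term of \<open>series_bimap_nth_top\<close>.\<close>
  have cut: "series_map (low n T) (fps_const X) = fps_cutoff n (series_map T (fps_const X))" for n X
    by (rule fps_ext, simp add: series_map_const[where T = T, OF linT]
        series_map_const[where T = "low n T" for n, OF linlow], simp add: low_def)
  have R_sym: "R n T X Y = R n T Y X" for n X Y
    unfolding R_def by (subst series_bimap_flip) (simp add: sym[symmetric] cong: if_cong)
  have "series_bimap B (series_map T (fps_const X)) (series_map T (fps_const Y)) = fps_const (B 0 X Y)"
    for X Y
  proof (rule fps_ext)
    fix n
    show "series_bimap B (series_map T (fps_const X)) (series_map T (fps_const Y)) $ n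
        = fps_const (B 0 X Y) $ n"
    proof (cases "n = 0")
      case True
      then show ?thesis
        by (simp add: series_bimap_def series_map_const[where T = T, OF linT] T0)
    next
      case False
      have "B 0 (T n U) V = - R n T U V / 2" for U V
        using T[of n] False by (simp add: P_def)
      moreover have "B 0 X (T n Y) = B 0 (T n Y) X"
        by (rule sym)
      \<comment> \<open>By symmetry of \<open>B 0\<close> and of \<open>R n T\<close>, the two terms
        containing \<open>T n\<close> each equal half of minus \<open>R n T X Y\<close>, so the
        coefficient vanishes.\<close>
      ultimately show ?thesis
        using False R_sym[of n Y X] series_bimap_nth_top[where F = B, OF bil,
            of n "series_map T (fps_const X)" "series_map T (fps_const Y)"]
        by (simp add: cut[symmetric] R_def[symmetric]) (simp add: series_map_const[where T = T, OF linT] T0)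
    qed
  qed
  with that T0 linT show ?thesis by blast
qed

section \<open>Transport of bracket and form along T\<close>

text \<open>A deformation gives invariance on constants only, whereas T sends constants to genuine
  series. Both sides are t-linear in each of the three arguments, so agreement on constants
  suffices.\<close>

lemma invariance_extends:
  assumes C: "\<And>n. bilinear_map scale scale (C n)" and B: "\<And>n. bilinear_map scale (*) (B n)"
    and inv: "\<And>X Y Z. series_bimap B (series_bimap C (fps_const X) (fps_const Y)) (fps_const Z) =
      - series_bimap B (fps_const Y) (series_bimap C (fps_const X) (fps_const Z))"
  shows "series_bimap B (series_bimap C x y) z = - series_bimap B y (series_bimap C x z)"
proof -
  note CL = series_bimap_t_linear_left[where F = C, OF C]
    and CR = series_bimap_t_linear_right[where F = C, OF C]
    and BL = series_bimap_t_linear_left[where F = B, OF B]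
    and BR = series_bimap_t_linear_right[where F = B, OF B]
  note comp = t_linear_compose[OF CL BL] t_linear_compose[OF CR BL]
    t_linear_compose[OF CL BR] t_linear_compose[OF CR BR]
  show ?thesis
  proof (rule t_linear_eqI[where x = x and s = scale and s' = "(*)"])
    fix X
    show "series_bimap B (series_bimap C (fps_const X) y) z
        = - series_bimap B y (series_bimap C (fps_const X) z)"
      by (rule t_linear_bi_eqI[where \<Phi> = "\<lambda>y z. series_bimap B (series_bimap C (fps_const X) y) z"
            and \<Psi> = "\<lambda>y z. - series_bimap B y (series_bimap C (fps_const X) z)"
            and s = scale and s' = "(*)"])
        (intro t_linear_uminus vector_space_complex comp BL BR inv)+
  qed (intro t_linear_uminus vector_space_complex comp)+
qed

theorem proposition5p4p1:
  fixes scale :: "complex \<Rightarrow> 'a::ab_group_add \<Rightarrow> 'a"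
    and Basis :: "'a set"
    and brk :: "'a \<Rightarrow> 'a \<Rightarrow> 'a"
    and form :: "'a \<Rightarrow> 'a \<Rightarrow> complex"
    and C :: "nat \<Rightarrow> 'a \<Rightarrow> 'a \<Rightarrow> 'a"
    and B :: "nat \<Rightarrow> 'a \<Rightarrow> 'a \<Rightarrow> complex"
  assumes "finite_dimensional_vector_space scale Basis"
    and "quadratic_lie_algebra scale brk form"
    and "quadratic_deformation scale brk form C B"
  shows "\<exists>C' B'. quadratic_deformation scale brk form C' B' \<and>
    B' = (\<lambda>n. if n = 0 then form else (\<lambda>X Y. 0)) \<and>
    equivalent_deformations scale C B C' B'"
proof -
  interpret quadratic_lie_algebra scale brk form by fact
  have C0: "C 0 = brk" and C: "\<And>n. bilinear_map scale scale (C n)"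
    and C_skew: "\<And>n x y. C n x y = - C n y x"
    and C_jacobi: "\<And>x y z. series_bimap C x (series_bimap C y z) + series_bimap C y (series_bimap C z x)
      + series_bimap C z (series_bimap C x y) = 0"
    and B0: "B 0 = form" and B: "\<And>n. bilinear_map scale (*) (B n)"
    and B_sym: "\<And>n x y. B n x y = B n y x"
    and B_inv: "\<And>X Y Z. series_bimap B (series_bimap C (fps_const X) (fps_const Y)) (fps_const Z) =
      - series_bimap B (fps_const Y) (series_bimap C (fps_const X) (fps_const Z))"
    using assms(3) unfolding quadratic_deformation_def bracket_deformation_def by blast+
  obtain T where T0: "T 0 = id" and T_lin: "\<And>n. Vector_Spaces.linear scale scale (T n)"
    and T_form: "\<And>X Y. series_bimap B (series_map T (fps_const X)) (series_map T (fps_const Y))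
      = fps_const (form X Y)"
    using form_deformation_trivial[where B = B, OF assms(1) B B_sym] form_nondegenerate unfolding B0 by metis
  define B' where "B' = (\<lambda>n::nat. if n = 0 then form else (\<lambda>X Y. 0))"
  \<comment> \<open>The bracket pulled back along T, as a map on series; \<open>C'\<close> is its
    series of coefficients.\<close>
  define \<Phi> where "\<Phi> x y = inv (series_map T) (series_bimap C (series_map T x) (series_map T y))" for x y
  define C' where "C' n X Y = \<Phi> (fps_const X) (fps_const Y) $ n" for n X Y
  note T_tl = series_map_t_linear[where T = T, OF T_lin]
  have bij: "bij (series_map T)"
    using T0 by (rule bij_series_map)
  note inv_tl = t_linear_inv[OF T_tl bij]
  have T_inv: "series_map T (inv (series_map T) x) = x" for x
    using bij by (simp add: bij_is_surj surj_f_inv_f)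
  have \<Phi>_left: "t_linear scale scale (\<lambda>x. \<Phi> x y)" and \<Phi>_right: "t_linear scale scale (\<Phi> x)" for x y
    unfolding \<Phi>_def
    by (rule t_linear_compose[OF _ inv_tl] t_linear_compose[OF T_tl]
        series_bimap_t_linear_left series_bimap_t_linear_right C)+
  have C': "bilinear_map scale scale (C' n)" for n
    by (rule series_bimap_eq_of_t_bilinear(1)[where \<Phi> = \<Phi> and F = C',
          OF vector_space_axioms vector_space_axioms \<Phi>_left \<Phi>_right C'_def])
  have C'_eq: "series_bimap C' x y = \<Phi> x y" for x y
    by (rule series_bimap_eq_of_t_bilinear(2)[where \<Phi> = \<Phi> and F = C',
          OF vector_space_axioms vector_space_axioms \<Phi>_left \<Phi>_right C'_def])
  \<comment> \<open>T is a homomorphism from the new bracket to the old one on all series; the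
    Jacobi identity and invariance are carried over by this.\<close>
  have T_C': "series_map T (series_bimap C' x y) = series_bimap C (series_map T x) (series_map T y)" for x y
    by (simp add: C'_eq \<Phi>_def T_inv)
  have BT_left: "t_linear scale (*) (\<lambda>x. series_bimap B (series_map T x) (series_map T y))"
    and BT_right: "t_linear scale (*) (\<lambda>y. series_bimap B (series_map T x) (series_map T y))" for x y
    by (rule t_linear_compose[OF T_tl] series_bimap_t_linear_left series_bimap_t_linear_right B)+
  \<comment> \<open>By the choice of T, the constant series \<open>B'\<close> consists of the
    coefficients of the pulled-back form, so its extension to all series is that pullback.\<close>
  have B'_nth: "B' n X Y =
      series_bimap B (series_map T (fps_const X)) (series_map T (fps_const Y)) $ n" for n X Y
    by (simp add: T_form B'_def)
  have B': "bilinear_map scale (*) (B' n)" for n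
    by (rule series_bimap_eq_of_t_bilinear(1)[where F = B'
          and \<Phi> = "\<lambda>x y. series_bimap B (series_map T x) (series_map T y)",
          OF vector_space_axioms vector_space_complex BT_left BT_right B'_nth])
  have B'_eq: "series_bimap B' x y = series_bimap B (series_map T x) (series_map T y)" for x y
    by (rule series_bimap_eq_of_t_bilinear(2)[where F = B'
          and \<Phi> = "\<lambda>x y. series_bimap B (series_map T x) (series_map T y)",
          OF vector_space_axioms vector_space_complex BT_left BT_right B'_nth])
  \<comment> \<open>T is the identity modulo t, so the pullback leaves the bracket at order 0
    unchanged.\<close>
  have T_nth0: "series_map T x $ 0 = x $ 0" for x
    by (simp add: series_map_def T0)
  have "C' 0 X Y = brk X Y" for X Y
  proof -
    have "C' 0 X Y = series_map T (\<Phi> (fps_const X) (fps_const Y)) $ 0"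
      by (simp add: C'_def T_nth0)
    then show ?thesis
      by (simp add: \<Phi>_def T_inv series_bimap_def T_nth0 C0)
  qed
  moreover have "C' n X Y = - C' n Y X" for n X Y
  proof -
    have "series_bimap C x y = - series_bimap C y x" for x y
      by (subst series_bimap_flip, subst C_skew)
        (simp add: series_bimap_def fps_eq_iff sum_negf)
    then have "\<Phi> (fps_const X) (fps_const Y) = - \<Phi> (fps_const Y) (fps_const X)"
      unfolding \<Phi>_def by (metis t_linear_minus[OF inv_tl])
    then show ?thesis by (simp add: C'_def)
  qed
  moreover have "series_bimap C' x (series_bimap C' y z) + series_bimap C' y (series_bimap C' z x)
      + series_bimap C' z (series_bimap C' x y) = 0" (is "?J = 0") for x y z
  proof -
    \<comment> \<open>T maps the Jacobi sum for \<open>C'\<close> to the one for C at the images of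
      x, y, z; injectivity of T finishes.\<close>
    have "series_map T ?J = 0"
      by (simp add: t_linear_add[OF T_tl] T_C' C_jacobi)
    then show ?thesis
      using t_linear_zero[OF T_tl] bij_is_inj[OF bij] by (metis injD)
  qed
  ultimately have "bracket_deformation scale brk C'"
    unfolding bracket_deformation_def using C' by blast
  moreover have "B' n x y = B' n y x" for n x y
    using form_sym by (simp add: B'_def)
  \<comment> \<open>Both sides pull back to the invariance of B under C at the images of x, y, z
    under T.\<close>
  moreover have "series_bimap B' (series_bimap C' x y) z = - series_bimap B' y (series_bimap C' x z)"
    for x y z
    by (simp add: B'_eq T_C' invariance_extends[where B = B and C = C, OF C B B_inv])
  ultimately have "quadratic_deformation scale brk form C' B'"
    unfolding quadratic_deformation_def using B' by (simp add: B'_def)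
  moreover have "equivalent_deformations scale C B C' B'"
    unfolding equivalent_deformations_def
    by (intro exI[of _ T] conjI allI T0 T_lin) (simp_all only: C'_eq B'_eq \<Phi>_def)
  ultimately show ?thesis
    unfolding B'_def by blast
qed

end
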